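(* Let $n,m\ge 1$, $\mathbf a\in\Delta_n$, $\mathbf b\in\Delta_m$, and let $\mathbf L=(L_{ijkl})$ be a symmetric real 4D tensor, with $(i,j),(k,l)\in\{1,\dots,n\}\times\{1,\dots,m\}$, that is conditionally negative semi-definite (CND) with respect to $\overline{\Pi}=\Pi(\mathbf a,\mathbf b)-\Pi(\mathbf a,\mathbf b)$. Then there exists an optimal solution $\mathbf P$ of the problem $$\min_{\mathbf P\in\Pi(\mathbf a,\mathbf b)}\ \langle \mathbf L\otimes\mathbf P,\mathbf P\rangle$$ which is an extreme point of $\Pi(\mathbf a,\mathbf b)$ and which satisfies $\operatorname{card}(\operatorname{supp}(\mathbf P))\le n+m-1$.
   Context: $\Delta_n=\{\mathbf a\in\mathbb R_+^n:\sum_{i=1}^n a_i=1\}$. $\Pi(\mathbf a,\mathbf b)=\{\mathbf P\in\mathbb R_+^{n\times m}:\mathbf P\mathbf 1_m=\mathbf a,\ \mathbf P^\top\mathbf 1_n=\mathbf b\}$, where $\mathbf 1_n$ is the all-ones vector of $\mathbb R^n$. $\langle\cdot,\cdot\rangle$ is the entrywise inner product of matrices, $\langle\mathbf A,\mathbf B\rangle=\sum_{ij}A_{ij}B_{ij}$. For a tensor $\mathbf L=(L_{ijkl})$ and a matrix $\mathbf P\in\mathbb R^{n\times m}$, $\mathbf L\otimes\mathbf P$ is the $n\times m$ matrix with $(k,l)$ entry $\sum_{ij}L_{ijkl}P_{ij}$, so $\langle\mathbf L\otimes\mathbf P,\mathbf P\rangle=\sum_{ijkl}L_{ijkl}P_{ij}P_{kl}$.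 $\mathbf L$ is symmetric if $L_{ijkl}=L_{klij}$ for all $i,j,k,l$. A symmetric tensor $\mathbf L$ is CND with respect to $\overline{\Pi}=\{\mathbf P_1-\mathbf P_2:\mathbf P_1,\mathbf P_2\in\Pi(\mathbf a,\mathbf b)\}$ if $\langle\mathbf L\otimes\mathbf Q,\mathbf Q\rangle\le 0$ for all $\mathbf Q\in\overline{\Pi}$. $\operatorname{supp}(\mathbf P)=\{(i,j):P_{ij}>0\}$. *)

theory Defs
  imports "HOL-Analysis.Analysis"
begin

definition prob_simplex :: "(real ^ 'n) set" where
  "prob_simplex = {a. (\<forall>i. 0 \<le> a $ i) \<and> (\<Sum>i\<in>UNIV. a $ i) = 1}"

(* The numeral 1 at a vector type is the all-ones vector (one_vec_def). *)
definition couplings :: "real ^ 'n \<Rightarrow> real ^ 'm \<Rightarrow> (real ^ 'm ^ 'n) set" where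
  "couplings a b =
     {P. (\<forall>i j. 0 \<le> P $ i $ j) \<and> P *v 1 = a \<and> transpose P *v 1 = b}"

definition coupling_diffs :: "real ^ 'n \<Rightarrow> real ^ 'm \<Rightarrow> (real ^ 'm ^ 'n) set" where
  "coupling_diffs a b = {P1 - P2 | P1 P2. P1 \<in> couplings a b \<and> P2 \<in> couplings a b}"

definition tensor_app :: "real ^ 'm ^ 'n ^ 'm ^ 'n \<Rightarrow> real ^ 'm ^ 'n \<Rightarrow> real ^ 'm ^ 'n" where
  "tensor_app L P = (\<chi> k l. \<Sum>i\<in>UNIV. \<Sum>j\<in>UNIV. L $ i $ j $ k $ l * P $ i $ j)"

definition symmetric_tensor :: "real ^ 'm ^ 'n ^ 'm ^ 'n \<Rightarrow> bool" where
  "symmetric_tensor L \<longleftrightarrow> (\<forall>i j k l. L $ i $ j $ k $ l = L $ k $ l $ i $ j)"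

(* The inner product on real ^ 'm ^ 'n is the entrywise one (inner_vec_def, applied twice). *)
definition CND :: "real ^ 'm ^ 'n ^ 'm ^ 'n \<Rightarrow> (real ^ 'm ^ 'n) set \<Rightarrow> bool" where
  "CND L S \<longleftrightarrow> (\<forall>Q\<in>S. tensor_app L Q \<bullet> Q \<le> 0)"

definition supp :: "real ^ 'm ^ 'n \<Rightarrow> ('n \<times> 'm) set" where
  "supp P = {(i, j). 0 < P $ i $ j}"

end

theory Submission
  imports Defs
begin

text \<open>On the convex compact set of couplings the CND condition makes the objective concave, so
  its negative has convex strict sublevel sets. Were all extreme points to be non-optimal, such a
  sublevel set would contain them and hence, by Krein--Milman, every minimiser, which is absurd.
  If the support of a coupling \<open>P\<close> has at least \<open>n + m\<close> cells, then some nonzero matrix carried by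
  this support has vanishing marginals, because all pairs of marginals lie in a hyperplane of
  dimension \<open>n + m - 1\<close>; moving \<open>P\<close> in both directions along it shows that \<open>P\<close> is not extreme.\<close>

lemma mem_couplings_iff:
  "P \<in> couplings a b \<longleftrightarrow>
     (\<forall>i j. 0 \<le> P $ i $ j) \<and> (\<forall>i. (\<Sum>j\<in>UNIV. P $ i $ j) = a $ i)
       \<and> (\<forall>j. (\<Sum>i\<in>UNIV. P $ i $ j) = b $ j)"
  by (simp add: couplings_def vec_eq_iff matrix_vector_mult_def transpose_def)

lemma couplings_nonempty:
  assumes "a \<in> prob_simplex" "b \<in> prob_simplex"
  shows "couplings a b \<noteq> {}"
proof -
  \<comment> \<open>The product coupling: summing out one index leaves the other marginal, because
    \<open>a\<close> and \<open>b\<close> have total mass one.\<close>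
  have "(\<chi> i j. a $ i * b $ j) \<in> couplings a b"
    using assms
    by (simp add: mem_couplings_iff prob_simplex_def flip: sum_distrib_left sum_distrib_right)
  then show ?thesis by blast
qed

lemma convex_couplings: "convex (couplings a b)"
  unfolding convex_def
  by (simp add: mem_couplings_iff sum.distrib flip: sum_distrib_left distrib_right)

text \<open>Serves to bound the couplings: for a nonnegative matrix with row sums \<open>a\<close>,
  the right-hand side is just the sum of the entries of \<open>a\<close>.\<close>

lemma norm_matrix_le_sum:
  fixes P :: "real ^ 'm ^ 'n"
  shows "norm P \<le> (\<Sum>i\<in>UNIV. \<Sum>j\<in>UNIV. \<bar>P $ i $ j\<bar>)"
proof -
  have "norm P \<le> (\<Sum>i\<in>UNIV. norm (P $ i))"
    unfolding norm_vec_def[of P] by (rule L2_set_le_sum) simp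
  also have "\<dots> \<le> (\<Sum>i\<in>UNIV. \<Sum>j\<in>UNIV. \<bar>P $ i $ j\<bar>)"
    by (intro sum_mono norm_le_l1_cart)
  finally show ?thesis .
qed

lemma compact_couplings: "compact (couplings a b)"
proof -
  have "closed (couplings a b)"
  proof -
    \<comment> \<open>In entrywise form the set is visibly an intersection of closed half-spaces and
      hyperplanes.\<close>
    have "couplings a b = {P. (\<forall>i j. 0 \<le> P $ i $ j) \<and> (\<forall>i. (\<Sum>j\<in>UNIV. P $ i $ j) = a $ i)
       \<and> (\<forall>j. (\<Sum>i\<in>UNIV. P $ i $ j) = b $ j)}"
      using mem_couplings_iff by blast
    then show ?thesis
      by (simp only:)
        (intro closed_Collect_conj closed_Collect_all closed_Collect_le closed_Collect_eq
          continuous_intros)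
  qed
  moreover have "norm P \<le> (\<Sum>i\<in>UNIV. a $ i)" if "P \<in> couplings a b" for P
    using norm_matrix_le_sum[of P] that by (simp add: mem_couplings_iff)
  then have "bounded (couplings a b)"
    by (auto simp: bounded_iff)
  ultimately show ?thesis
    by (simp add: compact_eq_bounded_closed)
qed

lemma linear_tensor_app:
  fixes L :: "real ^ 'm ^ 'n ^ 'm ^ 'n"
  shows "linear (tensor_app L)"
proof (rule linearI)
  fix P Q :: "real ^ 'm ^ 'n" and c :: real
  show "tensor_app L (P + Q) = tensor_app L P + tensor_app L Q"
    by (simp add: tensor_app_def vec_eq_iff distrib_left sum.distrib)
  show "tensor_app L (c *\<^sub>R P) = c *\<^sub>R tensor_app L P"
    by (simp add: tensor_app_def vec_eq_iff sum_distrib_left mult_ac)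
qed

text \<open>Swapping the order of summation over the two index pairs exchanges the roles of
  \<open>P\<close> and \<open>Q\<close>, and symmetry of \<open>L\<close> absorbs the exchange of
  its indices.\<close>

lemma tensor_app_inner_commute:
  assumes "symmetric_tensor L"
  shows "tensor_app L P \<bullet> Q = tensor_app L Q \<bullet> P"
proof -
  have expand: "tensor_app L P \<bullet> Q =
      (\<Sum>(k, l)\<in>UNIV. \<Sum>(i, j)\<in>UNIV. L $ i $ j $ k $ l * P $ i $ j * Q $ k $ l)" for P Q
    unfolding UNIV_Times_UNIV[symmetric] sum.cartesian_product[symmetric]
    by (simp add: tensor_app_def inner_vec_def sum_distrib_right)
  have "tensor_app L P \<bullet> Q =
      (\<Sum>(i, j)\<in>UNIV. \<Sum>(k, l)\<in>UNIV. L $ i $ j $ k $ l * P $ i $ j * Q $ k $ l)"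
    unfolding expand case_prod_unfold by (rule sum.swap)
  also have "\<dots> = tensor_app L Q \<bullet> P"
    using assms unfolding expand symmetric_tensor_def
    by (intro sum.cong refl) (simp add: case_prod_unfold mult_ac)
  finally show ?thesis .
qed

text \<open>Since u + v = 1, u^2 = u - uv and v^2 = v - uv. The corrections -uv combine with the two
  equal cross terms into the form at \<open>P - Q\<close>, the only place where CND has to be
  used.\<close>

lemma tensor_form_convex_combination:
  assumes "symmetric_tensor L" and "u + v = 1"
  shows "tensor_app L (u *\<^sub>R P + v *\<^sub>R Q) \<bullet> (u *\<^sub>R P + v *\<^sub>R Q) =
    u * (tensor_app L P \<bullet> P) + v * (tensor_app L Q \<bullet> Q)
      - u * v * (tensor_app L (P - Q) \<bullet> (P - Q))"
proof -
  have v: "v = 1 - u" using assms(2) by simp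
  show ?thesis
    unfolding v using tensor_app_inner_commute[OF assms(1), of Q P]
    by (simp add: linear_add[OF linear_tensor_app] linear_diff[OF linear_tensor_app]
        linear_scale[OF linear_tensor_app] inner_simps algebra_simps)
qed

lemma concave_on_tensor_form:
  assumes "symmetric_tensor L" and "CND L (coupling_diffs a b)"
  shows "concave_on (couplings a b) (\<lambda>P. tensor_app L P \<bullet> P)"
  unfolding concave_on_iff
proof (intro conjI convex_couplings ballI allI impI)
  fix P Q and u v :: real
  assume PQ: "P \<in> couplings a b" "Q \<in> couplings a b" and uv: "0 \<le> u" "0 \<le> v" "u + v = 1"
  have "tensor_app L (P - Q) \<bullet> (P - Q) \<le> 0"
    using assms(2) PQ unfolding CND_def coupling_diffs_def by blast
  then have "u * v * (tensor_app L (P - Q) \<bullet> (P - Q)) \<le> 0"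
    using uv by (simp add: mult_nonneg_nonpos)
  then show "u * (tensor_app L P \<bullet> P) + v * (tensor_app L Q \<bullet> Q)
      \<le> tensor_app L (u *\<^sub>R P + v *\<^sub>R Q) \<bullet> (u *\<^sub>R P + v *\<^sub>R Q)"
    using tensor_form_convex_combination[OF assms(1) uv(3), of P Q] by linarith
qed

lemma concave_attains_min_at_extreme_point:
  fixes f :: "'a::euclidean_space \<Rightarrow> real"
  assumes "compact K" "K \<noteq> {}" "continuous_on K f" "concave_on K f"
  obtains x where "x extreme_point_of K" "\<And>y. y \<in> K \<Longrightarrow> f x \<le> f y"
proof -
  have K: "convex K" using assms(4) by (simp add: concave_on_iff)
  obtain m where m: "m \<in> K" "\<And>y. y \<in> K \<Longrightarrow> f m \<le> f y"
    using continuous_attains_inf[OF assms(1-3)] by blast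
  have "\<exists>x. x extreme_point_of K \<and> f x \<le> f m"
  proof (rule ccontr)
    assume neg: "\<nexists>x. x extreme_point_of K \<and> f x \<le> f m"
    let ?S = "{x \<in> K. f m < f x}"
    have "convex ?S"
    proof (rule convexI)
      fix x y and u v :: real
      assume x: "x \<in> ?S" and y: "y \<in> ?S" and uv: "0 \<le> u" "0 \<le> v" "u + v = 1"
      have "f m < u * f x + v * f y"
        \<comment> \<open>The library bound concerns strict upper bounds, hence the negated
          values.\<close>
        using convex_bound_lt[of "- f x" "- f m" "- f y" u v] x y uv by simp
      also have "\<dots> \<le> f (u *\<^sub>R x + v *\<^sub>R y)"
        using assms(4) x y uv by (simp add: concave_on_iff)
      finally show "u *\<^sub>R x + v *\<^sub>R y \<in> ?S"
        using x y uv K by (simp add: convexD)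
    qed
    moreover have "{x. x extreme_point_of K} \<subseteq> ?S"
      using neg by (auto simp: not_le extreme_point_of_def)
    ultimately have "convex hull {x. x extreme_point_of K} \<subseteq> ?S"
      by (rule hull_minimal[rotated])
    \<comment> \<open>By Krein-Milman \<open>K\<close> is the convex hull of its extreme points;
      membership of \<open>m\<close> in \<open>?S\<close> then reads
      \<open>f m < f m\<close>.\<close>
    then have "m \<in> ?S"
      using Krein_Milman_Minkowski[OF assms(1) K] m(1) by blast
    then show False by simp
  qed
  then obtain x where "x extreme_point_of K" "f x \<le> f m" by blast
  then show ?thesis using m(2) by (meson order_trans that)
qed

lemma exists_supported_zero_marginals:
  fixes S :: "('n::finite \<times> 'm::finite) set"
  assumes "CARD('n) + CARD('m) \<le> card S"
  obtains Q :: "real ^ 'm ^ 'n" where "Q \<noteq> 0" "\<And>i j. (i, j) \<notin> S \<Longrightarrow> Q $ i $ j = 0"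
    "\<And>i. (\<Sum>j\<in>UNIV. Q $ i $ j) = 0" "\<And>j. (\<Sum>i\<in>UNIV. Q $ i $ j) = 0"
proof -
  define T :: "real ^ 'm ^ 'n \<Rightarrow> (real ^ 'n) \<times> (real ^ 'm)"
    where "T Q = (\<chi> i. \<Sum>j\<in>UNIV. Q $ i $ j, \<chi> j. \<Sum>i\<in>UNIV. Q $ i $ j)" for Q
  \<comment> \<open>The matrix units at the cells of \<open>S\<close>. They belong to the standard
    basis, so their span has dimension \<open>card S\<close>.\<close>
  define B :: "(real ^ 'm ^ 'n) set" where "B = (\<lambda>(i, j). axis i (axis j 1)) ` S"
  \<comment> \<open>A normal vector of the hyperplane containing the range of \<open>T\<close>: row
    sums and column sums both add up to the sum of all entries.\<close>
  define w :: "(real ^ 'n) \<times> (real ^ 'm)" where "w = (1, - 1)"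
  have lin: "linear T"
    by (rule linearI)
      (simp_all add: T_def vec_eq_iff sum.distrib sum_distrib_left)
  have entry: "(axis i (axis j 1) :: real ^ 'm ^ 'n) $ k $ l = (if k = i \<and> l = j then 1 else 0)"
    for i j k l
    by (simp add: axis_def)
  have "inj_on (\<lambda>(i, j). axis i (axis j 1) :: real ^ 'm ^ 'n) S"
    by (rule inj_onI) (auto simp: axis_eq_axis)
  then have cardB: "card B = card S"
    unfolding B_def by (rule card_image)
  have "B \<subseteq> Basis"
    by (auto simp: B_def axis_in_Basis_iff)
  then have "independent B"
    using independent_Basis independent_mono by blast
  then have dimB: "dim (span B) = card S"
    by (simp add: dim_eq_card_independent cardB)
  have "w \<bullet> T Q = 0" for Q
    using sum.swap[of "\<lambda>i j. Q $ i $ j" UNIV UNIV]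
    by (simp add: T_def w_def inner_vec_def sum_negf)
  then have "T ` span B \<subseteq> {x. w \<bullet> x = 0}" by blast
  then have "dim (T ` span B) \<le> dim {x. w \<bullet> x = 0}" by (rule dim_subset)
  also have "\<dots> = DIM((real ^ 'n) \<times> (real ^ 'm)) - 1"
    by (rule dim_hyperplane) (simp add: w_def zero_prod_def)
  \<comment> \<open>Subtraction on naturals is truncated, so strictness needs a positive dimension;
    index types are nonempty.\<close>
  also have "\<dots> < card S"
    using assms zero_less_card_finite[where 'a='n] by (simp del: zero_less_card_finite)
  \<comment> \<open>An injective \<open>T\<close> would preserve the dimension \<open>card S\<close>
    of \<open>span B\<close>.\<close>
  finally have "\<not> inj_on T (span B)"
    using dim_image_eq[OF lin, of "span B"] dimB by (auto simp: span_span)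
  then obtain Q where Q: "Q \<in> span B" "T Q = 0" "Q \<noteq> 0"
    using linear_injective_on_subspace_0[OF lin subspace_span, of B] by auto
  have "subspace {Q :: real ^ 'm ^ 'n. \<forall>i j. (i, j) \<notin> S \<longrightarrow> Q $ i $ j = 0}"
    by (auto simp: subspace_def)
  moreover have "B \<subseteq> {Q. \<forall>i j. (i, j) \<notin> S \<longrightarrow> Q $ i $ j = 0}"
    by (auto simp: B_def entry)
  ultimately have "Q \<in> {Q. \<forall>i j. (i, j) \<notin> S \<longrightarrow> Q $ i $ j = 0}"
    using Q(1) span_minimal by blast
  with Q(2,3) show ?thesis
    by (intro that[of Q]) (simp_all add: T_def vec_eq_iff zero_prod_def)
qed

lemma card_supp_extreme_point:
  fixes a :: "real ^ 'n" and b :: "real ^ 'm"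
  assumes ext: "P extreme_point_of couplings a b"
  shows "card (supp P) \<le> CARD('n) + CARD('m) - 1"
proof (rule ccontr)
  assume "\<not> ?thesis"
  then have "CARD('n) + CARD('m) \<le> card (supp P)" by simp
  then obtain Q :: "real ^ 'm ^ 'n" where Q: "Q \<noteq> 0"
    "\<And>i j. (i, j) \<notin> supp P \<Longrightarrow> Q $ i $ j = 0"
    "\<And>i. (\<Sum>j\<in>UNIV. Q $ i $ j) = 0" "\<And>j. (\<Sum>i\<in>UNIV. Q $ i $ j) = 0"
    using exists_supported_zero_marginals by blast
  have P: "P \<in> couplings a b" using ext by (simp add: extreme_point_of_def)
  \<comment> \<open>A positive lower bound for all entries on the support. The inserted 1 keeps the
    set nonempty, so that \<open>Min\<close> is meaningful without a case distinction.\<close>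
  define d where "d = Min (insert 1 ((\<lambda>(i, j). P $ i $ j) ` supp P))"
  have d_pos: "0 < d"
    by (auto simp: d_def supp_def)
  have d_le: "d \<le> P $ i $ j" if "(i, j) \<in> supp P" for i j
    unfolding d_def using that by (intro Min_le) (simp, force)
  \<comment> \<open>Every entry of \<open>Q\<close> is at most \<open>norm Q\<close> in absolute
    value, so this scaling keeps the entries of \<open>e *\<^sub>R Q\<close> within
    \<open>d\<close>.\<close>
  define e where "e = d / norm Q"
  have e: "0 < e" using d_pos Q(1) by (simp add: e_def)
  have bound: "\<bar>e * Q $ i $ j\<bar> \<le> P $ i $ j" for i j
  proof (cases "(i, j) \<in> supp P")
    case True
    have "\<bar>Q $ i $ j\<bar> \<le> norm Q"
      using component_le_norm_cart[of "Q $ i" j] Finite_Cartesian_Product.norm_nth_le[of Q i] by linarith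
    then have "\<bar>e * Q $ i $ j\<bar> \<le> e * norm Q"
      using e by (simp add: abs_mult)
    also have "\<dots> = d" using Q(1) by (simp add: e_def)
    finally show ?thesis using d_le[OF True] by simp
  next
    case False
    then show ?thesis using Q(2) P by (simp add: mem_couplings_iff)
  qed
  \<comment> \<open>Stated with the absolute value of \<open>c\<close> to cover both directions at
    once. The marginals of \<open>Q\<close> vanish, so only nonnegativity is at stake.\<close>
  have perturb: "P + c *\<^sub>R Q \<in> couplings a b" if "\<bar>c\<bar> = e" for c
  proof -
    have "0 \<le> P $ i $ j + c * Q $ i $ j" for i j
    proof -
      have "\<bar>c * Q $ i $ j\<bar> = \<bar>e * Q $ i $ j\<bar>"
        using that e by (simp add: abs_mult)
      then show ?thesis using bound[of i j] by linarith
    qed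
    moreover have "(\<Sum>j\<in>UNIV. c * Q $ i $ j) = 0" "(\<Sum>i\<in>UNIV. c * Q $ i $ j) = 0" for i j
      by (simp_all only: Q(3,4) mult_zero_right flip: sum_distrib_left)
    ultimately show ?thesis
      using P unfolding mem_couplings_iff by (simp add: sum.distrib)
  qed
  let ?A = "P + e *\<^sub>R Q" and ?B = "P + (- e) *\<^sub>R Q"
  have mid: "midpoint ?A ?B = P"
    by (simp add: midpoint_def algebra_simps flip: scaleR_2[of P])
  have "?A \<noteq> ?B"
    using e Q(1) by (simp flip: scaleR_minus_left)
  then have "P \<in> open_segment ?A ?B"
    using midpoint_in_open_segment[of ?A ?B] unfolding mid by blast
  moreover have "?A \<in> couplings a b" "?B \<in> couplings a b"
    using e by (intro perturb; simp)+
  ultimately show False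
    using ext unfolding extreme_point_of_def by blast
qed

theorem corollary2:
  fixes a :: "real ^ 'n" and b :: "real ^ 'm"
    and L :: "real ^ 'm ^ 'n ^ 'm ^ 'n"
  assumes "a \<in> prob_simplex" and "b \<in> prob_simplex"
    and "symmetric_tensor L"
    and "CND L (coupling_diffs a b)"
  shows "\<exists>P. is_arg_min (\<lambda>P. tensor_app L P \<bullet> P) (\<lambda>P. P \<in> couplings a b) P
           \<and> P extreme_point_of couplings a b
           \<and> card (supp P) \<le> CARD('n) + CARD('m) - 1"
proof -
  have "continuous_on (couplings a b) (\<lambda>P. tensor_app L P \<bullet> P)"
    by (intro continuous_intros linear_continuous_on_compose[OF _ linear_tensor_app])
  then obtain P where P: "P extreme_point_of couplings a b"
    "\<And>R. R \<in> couplings a b \<Longrightarrow> tensor_app L P \<bullet> P \<le> tensor_app L R \<bullet> R"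
    using concave_attains_min_at_extreme_point[OF compact_couplings
        couplings_nonempty[OF assms(1,2)] _ concave_on_tensor_form[OF assms(3,4)]]
    by blast
  \<comment> \<open>Membership of \<open>P\<close> in the feasible set is part of being an extreme
    point.\<close>
  then have "is_arg_min (\<lambda>P. tensor_app L P \<bullet> P) (\<lambda>P. P \<in> couplings a b) P"
    by (simp add: is_arg_min_linorder extreme_point_of_def)
  with P(1) card_supp_extreme_point show ?thesis by blast
qed

end
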